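(* Let $G,H$ be topological groups and let $\varphi\colon G\to H$ be a continuous homomorphism. Then $\varphi(\operatorname{Kor}(G))\le\operatorname{Kor}(H)$. In particular, mapping $G$ to $\operatorname{Kor}(G)$ and $\varphi$ to its restriction and corestriction $\operatorname{Kor}(\varphi):=\varphi|_{\operatorname{Kor}(G)}^{\operatorname{Kor}(H)}\colon\operatorname{Kor}(G)\to\operatorname{Kor}(H)$ defines a functor from the category of topological groups (with continuous homomorphisms) to itself.
   Context: All topological groups are Hausdorff. For a topological group $G$, an ordinary representation of $G$ is a continuous homomorphism $\rho\colon G\to \mathrm{GL}_n(\mathbb{C})$ for some positive integer $n$, and $\operatorname{Kor}(G)$ denotes the intersection of the kernels of all ordinary representations of $G$ (over all $n$), with the subspace topology. *)

theory Defs
  imports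
    "HOL-Analysis.Analysis"
    "HOL-Algebra.Algebra"
    "Jordan_Normal_Form.Matrix"
begin

section \<open>Topological groups\<close>

record 'a topgroup = "'a monoid" +
  grp_top :: "'a topology"

locale topological_group = group G for G :: "('a, 'b) topgroup_scheme" (structure) +
  assumes topspace_eq: "topspace (grp_top G) = carrier G"
    and Hausdorff: "Hausdorff_space (grp_top G)"
    and continuous_mult:
      "continuous_map (prod_topology (grp_top G) (grp_top G)) (grp_top G) (\<lambda>(x, y). x \<otimes> y)"
    and continuous_inv: "continuous_map (grp_top G) (grp_top G) (\<lambda>x. inv x)"

definition continuous_hom ::
    "('a, 'c) topgroup_scheme \<Rightarrow> ('b, 'd) topgroup_scheme \<Rightarrow> ('a \<Rightarrow> 'b) set" where
  "continuous_hom G H = {f \<in> hom G H. continuous_map (grp_top G) (grp_top H) f}"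


section \<open>Ordinary representations and the subgroup Kor\<close>

text \<open>The topology of the complex general linear group is the one induced by the product topology
  on the \<open>n * n\<close> matrix entries.\<close>

definition GL :: "nat \<Rightarrow> complex mat topgroup" where
  "GL n = (let M = {A \<in> carrier_mat n n. invertible_mat A} in
     \<lparr> carrier = M, mult = (*), one = 1\<^sub>m n,
       grp_top = pullback_topology M (\<lambda>A. \<lambda>(i, j) \<in> {..<n} \<times> {..<n}. A $$ (i, j))
         (product_topology (\<lambda>_. euclidean) ({..<n} \<times> {..<n})) \<rparr>)"

definition ordinary_representation ::
    "('a, 'b) topgroup_scheme \<Rightarrow> nat \<Rightarrow> ('a \<Rightarrow> complex mat) \<Rightarrow> bool" where
  "ordinary_representation G n \<rho> \<longleftrightarrow> n > 0 \<and> \<rho> \<in> continuous_hom G (GL n)"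

definition Kor_carrier :: "('a, 'b) topgroup_scheme \<Rightarrow> 'a set" where
  "Kor_carrier G = \<Inter> {kernel G (GL n) \<rho> | n \<rho>. ordinary_representation G n \<rho>}"

definition Kor :: "'a topgroup \<Rightarrow> 'a topgroup" where
  "Kor G = G\<lparr>carrier := Kor_carrier G, grp_top := subtopology (grp_top G) (Kor_carrier G)\<rparr>"


section \<open>Categories and functors\<close>

text \<open>Hom-sets need not be disjoint, so composition and the action of a functor on morphisms
  take the objects involved as arguments: \<open>Comp C x y z g f\<close> is the composite of
  \<open>f : x \<rightarrow> y\<close> and \<open>g : y \<rightarrow> z\<close>.\<close>

record ('o, 'm) cat =
  Ob :: "'o set"
  Hom :: "'o \<Rightarrow> 'o \<Rightarrow> 'm set"
  Ident :: "'o \<Rightarrow> 'm"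
  Comp :: "'o \<Rightarrow> 'o \<Rightarrow> 'o \<Rightarrow> 'm \<Rightarrow> 'm \<Rightarrow> 'm"

locale cat_axioms =
  fixes C :: "('o, 'm) cat"
  assumes Ident_in_Hom: "x \<in> Ob C \<Longrightarrow> Ident C x \<in> Hom C x x"
    and Comp_in_Hom:
      "\<lbrakk>x \<in> Ob C; y \<in> Ob C; z \<in> Ob C; f \<in> Hom C x y; g \<in> Hom C y z\<rbrakk>
        \<Longrightarrow> Comp C x y z g f \<in> Hom C x z"
    and Comp_Ident_left:
      "\<lbrakk>x \<in> Ob C; y \<in> Ob C; f \<in> Hom C x y\<rbrakk> \<Longrightarrow> Comp C x y y (Ident C y) f = f"
    and Comp_Ident_right:
      "\<lbrakk>x \<in> Ob C; y \<in> Ob C; f \<in> Hom C x y\<rbrakk> \<Longrightarrow> Comp C x x y f (Ident C x) = f"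
    and Comp_assoc:
      "\<lbrakk>w \<in> Ob C; x \<in> Ob C; y \<in> Ob C; z \<in> Ob C;
        f \<in> Hom C w x; g \<in> Hom C x y; h \<in> Hom C y z\<rbrakk>
        \<Longrightarrow> Comp C w x z (Comp C x y z h g) f = Comp C w y z h (Comp C w x y g f)"

locale cat_functor = source: cat_axioms C + target: cat_axioms D
  for C :: "('o, 'm) cat" and D :: "('p, 'n) cat" +
  fixes F_ob :: "'o \<Rightarrow> 'p"
    and F_mor :: "'o \<Rightarrow> 'o \<Rightarrow> 'm \<Rightarrow> 'n"
  assumes F_ob: "x \<in> Ob C \<Longrightarrow> F_ob x \<in> Ob D"
    and F_mor:
      "\<lbrakk>x \<in> Ob C; y \<in> Ob C; f \<in> Hom C x y\<rbrakk> \<Longrightarrow> F_mor x y f \<in> Hom D (F_ob x) (F_ob y)"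
    and F_Ident: "x \<in> Ob C \<Longrightarrow> F_mor x x (Ident C x) = Ident D (F_ob x)"
    and F_Comp:
      "\<lbrakk>x \<in> Ob C; y \<in> Ob C; z \<in> Ob C; f \<in> Hom C x y; g \<in> Hom C y z\<rbrakk>
        \<Longrightarrow> F_mor x z (Comp C x y z g f)
          = Comp D (F_ob x) (F_ob y) (F_ob z) (F_mor y z g) (F_mor x y f)"


section \<open>The category of topological groups\<close>

text \<open>The type variable \<open>'u\<close> plays the role of the universe: the objects are all topological
  groups whose carrier is a set of elements of \<open>'u\<close>. Morphisms are extensional functions, so that
  two morphisms are equal as soon as they agree on the carrier of their domain.\<close>

definition TopGrp :: "('u topgroup, 'u \<Rightarrow> 'u) cat" where
  "TopGrp =
    \<lparr> Ob = {G. topological_group G},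
      Hom = (\<lambda>G H. continuous_hom G H \<inter> extensional (carrier G)),
      Ident = (\<lambda>G. \<lambda>x \<in> carrier G. x),
      Comp = (\<lambda>G H K g f. compose (carrier G) g f) \<rparr>"

text \<open>Functions do not carry a codomain in HOL, so the corestriction is visible only in the
  hom-set in which the restricted map is considered.\<close>

definition Kor_mor :: "'a topgroup \<Rightarrow> 'b topgroup \<Rightarrow> ('a \<Rightarrow> 'b) \<Rightarrow> 'a \<Rightarrow> 'b" where
  "Kor_mor G H \<phi> = restrict \<phi> (carrier (Kor G))"

end

theory Submission
  imports Defs
begin

text \<open>Ordinary representations pull back: if \<open>\<rho>\<close> represents H, then
  \<open>\<rho> \<circ> \<phi>\<close> represents G in the same dimension. An element x of Kor(G) is
  killed by every such pullback, so \<open>\<phi> x\<close> is killed by every \<open>\<rho>\<close>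
  and lies in Kor(H); this is \<open>Kor_carrier_image\<close>. Kor(G) is a subgroup because it is
  an intersection of kernels (\<open>subgroup_Kor_carrier\<close>), and any subgroup with the
  subspace topology is again a topological group (\<open>topological_group_subgroup\<close>), so Kor
  stays inside the category. Functoriality then reduces to the equality of extensional functions on
  Kor(G).\<close>

lemma group_GL: "group (GL n)"
proof (rule groupI)
  have GL_carrier: "carrier (GL n) = {A \<in> carrier_mat n n. \<exists>B \<in> carrier_mat n n. A * B = 1\<^sub>m n \<and> B * A = 1\<^sub>m n}"
  proof (intro equalityI subsetI)
    fix A assume "A \<in> carrier (GL n)"
    then have A: "A \<in> carrier_mat n n" and "invertible_mat A"
      by (auto simp: GL_def Let_def)
    then obtain B where B: "A * B = 1\<^sub>m n" "B * A = 1\<^sub>m (dim_row B)"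
      by (auto simp: invertible_mat_def inverts_mat_def)
    \<comment> \<open>\<open>invertible_mat\<close> does not fix the shape of the inverse. Its
      column count is read off A * B, and its row count off B * A, whose column count is that of
      A.\<close>
    have "dim_col B = n"
      using arg_cong[OF B(1), of dim_col] by simp
    moreover have "dim_row B = n"
      using arg_cong[OF B(2), of dim_col] A by simp
    ultimately have "B \<in> carrier_mat n n" by auto
    then show "A \<in> {A \<in> carrier_mat n n. \<exists>B \<in> carrier_mat n n. A * B = 1\<^sub>m n \<and> B * A = 1\<^sub>m n}"
      using A B by auto
  next
    fix A :: "complex mat"
    assume "A \<in> {A \<in> carrier_mat n n. \<exists>B \<in> carrier_mat n n. A * B = 1\<^sub>m n \<and> B * A = 1\<^sub>m n}"
    then show "A \<in> carrier (GL n)"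
      by (auto simp: GL_def Let_def invertible_mat_def inverts_mat_def)
  qed
  have GL_mult: "x \<otimes>\<^bsub>GL n\<^esub> y = x * y" and GL_one: "\<one>\<^bsub>GL n\<^esub> = 1\<^sub>m n" for x y
    by (simp_all add: GL_def Let_def)
  fix A B C :: "complex mat"
  show "\<one>\<^bsub>GL n\<^esub> \<in> carrier (GL n)"
    unfolding GL_carrier GL_one by (auto intro!: bexI[of _ "1\<^sub>m n"])
  assume A: "A \<in> carrier (GL n)"
  then obtain A' where A': "A \<in> carrier_mat n n" "A' \<in> carrier_mat n n" "A * A' = 1\<^sub>m n" "A' * A = 1\<^sub>m n"
    by (auto simp: GL_carrier)
  show "\<one>\<^bsub>GL n\<^esub> \<otimes>\<^bsub>GL n\<^esub> A = A"
    using A' by (simp add: GL_one GL_mult)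
  show "\<exists>y\<in>carrier (GL n). y \<otimes>\<^bsub>GL n\<^esub> A = \<one>\<^bsub>GL n\<^esub>"
    using A' by (auto simp: GL_carrier GL_one GL_mult)
  assume B: "B \<in> carrier (GL n)"
  then obtain B' where B': "B \<in> carrier_mat n n" "B' \<in> carrier_mat n n" "B * B' = 1\<^sub>m n" "B' * B = 1\<^sub>m n"
    by (auto simp: GL_carrier)
  \<comment> \<open>Used for both sides of the inverse of A * B: once as it stands, once with the
    roles of the matrices and their inverses exchanged.\<close>
  have cancel: "(P * Q) * (Q' * P') = 1\<^sub>m n"
    if "P \<in> carrier_mat n n" "Q \<in> carrier_mat n n" "Q' \<in> carrier_mat n n" "P' \<in> carrier_mat n n"
      "Q * Q' = 1\<^sub>m n" "P * P' = 1\<^sub>m n" for P Q P' Q' :: "complex mat"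
  proof -
    have "(P * Q) * (Q' * P') = P * (Q * (Q' * P'))"
      using that(1-4) by (intro assoc_mult_mat) auto
    also have "Q * (Q' * P') = (Q * Q') * P'"
      using that(1-4) by (intro assoc_mult_mat[symmetric]) auto
    finally show ?thesis using that by simp
  qed
  have "(A * B) * (B' * A') = 1\<^sub>m n" "(B' * A') * (A * B) = 1\<^sub>m n"
    using A' B' by (auto intro!: cancel)
  then show "A \<otimes>\<^bsub>GL n\<^esub> B \<in> carrier (GL n)"
    unfolding GL_carrier GL_mult using A'(1,2) B'(1,2)
    by (intro CollectI conjI bexI[of _ "B' * A'"] mult_carrier_mat)
  assume "C \<in> carrier (GL n)"
  then have "C \<in> carrier_mat n n" by (auto simp: GL_carrier)
  then show "A \<otimes>\<^bsub>GL n\<^esub> B \<otimes>\<^bsub>GL n\<^esub> C = A \<otimes>\<^bsub>GL n\<^esub> (B \<otimes>\<^bsub>GL n\<^esub> C)"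
    using A' B' by (simp add: GL_mult)
qed

text \<open>The entry map is restricted to the index set, hence extensional, so it sends every
  matrix into the topspace of the product and the pullback loses no point.\<close>

lemma topspace_GL: "topspace (grp_top (GL n)) = carrier (GL n)"
  by (auto simp: GL_def Let_def topspace_pullback_topology)

lemma continuous_hom_compose:
  assumes "\<phi> \<in> continuous_hom G H" "\<psi> \<in> continuous_hom H K"
  shows "\<psi> \<circ> \<phi> \<in> continuous_hom G K"
  using assms hom_compose[of \<phi> G H \<psi> K]
    continuous_map_compose[of "grp_top G" "grp_top H" \<phi> "grp_top K" \<psi>]
  by (auto simp: continuous_hom_def)

context topological_group
begin

text \<open>Ensures that the family of kernels defining Kor is nonempty. In HOL an empty
  intersection would be the whole type, not the carrier of G.\<close>

lemma trivial_representation: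
  assumes "n > 0"
  shows "ordinary_representation G n (\<lambda>_. \<one>\<^bsub>GL n\<^esub>)"
proof -
  interpret GL: group "GL n" by (rule group_GL)
  show ?thesis
    using assms
    by (simp add: ordinary_representation_def continuous_hom_def hom_def topspace_GL)
qed

lemma subgroup_Kor_carrier: "subgroup (Kor_carrier G) G"
  unfolding Kor_carrier_def
proof (rule subgroups_Inter)
  fix K assume "K \<in> {kernel G (GL n) \<rho> |n \<rho>. ordinary_representation G n \<rho>}"
  then obtain n \<rho> where K: "K = kernel G (GL n) \<rho>" and \<rho>: "\<rho> \<in> hom G (GL n)"
    by (auto simp: ordinary_representation_def continuous_hom_def)
  interpret group_hom G "GL n" \<rho>
    using \<rho> group_GL by (simp add: group_hom_def group_hom_axioms_def is_group)
  show "subgroup K G" unfolding K by (rule subgroup_kernel)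
qed (use trivial_representation[of 1] in auto)

text \<open>The operations of G are continuous and preserve \<open>K\<close>, so they restrict to
  continuous maps for the subspace topology; the Hausdorff property passes to subspaces.\<close>

lemma topological_group_subgroup:
  assumes "subgroup K G"
  shows "topological_group (G\<lparr>carrier := K, grp_top := subtopology (grp_top G) K\<rparr>)"
    (is "topological_group ?K")
proof -
  interpret K: subgroup K G by fact
  have K_group: "group ?K"
    by (rule groupI) (auto simp: m_assoc intro!: bexI[where x = "inv _"])
  \<comment> \<open>Inversion in a record depends on its carrier, so it has to be identified with
    inversion in G before continuity can be transferred.\<close>
  have inv_K: "inv\<^bsub>?K\<^esub> x = inv x" if "x \<in> K" for x
    by (rule group.inv_equality[OF K_group]) (use that in auto)
  \<comment> \<open>Continuity is obtained on the subspace \<open>K \<times> K\<close> of the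
    product, which by \<open>subtopology_Times\<close> is the product of the subspaces.\<close>
  have "continuous_map (subtopology (prod_topology (grp_top G) (grp_top G)) (K \<times> K))
          (subtopology (grp_top G) K) (\<lambda>(x, y). x \<otimes> y)"
    using continuous_mult
    by (auto simp: continuous_map_in_subtopology continuous_map_from_subtopology)
  then have mult_cont: "continuous_map (prod_topology (grp_top ?K) (grp_top ?K)) (grp_top ?K)
      (\<lambda>(x, y). x \<otimes>\<^bsub>?K\<^esub> y)"
    by (simp add: subtopology_Times)
  have "continuous_map (subtopology (grp_top G) K) (subtopology (grp_top G) K) (\<lambda>x. inv x)"
    using continuous_inv
    by (auto simp: continuous_map_in_subtopology continuous_map_from_subtopology)
  then have inv_cont: "continuous_map (grp_top ?K) (grp_top ?K) (\<lambda>x. inv\<^bsub>?K\<^esub> x)"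
    using continuous_map_eq[of "subtopology (grp_top G) K" "subtopology (grp_top G) K"
        "\<lambda>x. inv x" "\<lambda>x. inv\<^bsub>?K\<^esub> x"]
    by (simp add: inv_K)
  show ?thesis
    using K_group mult_cont inv_cont Hausdorff topspace_eq K.subset
    by (auto simp: topological_group_def topological_group_axioms_def Hausdorff_space_subtopology)
qed

end

lemma Kor_carrier_subset: "topological_group G \<Longrightarrow> Kor_carrier G \<subseteq> carrier G"
  by (rule subgroup.subset[OF topological_group.subgroup_Kor_carrier])

lemma carrier_Kor: "carrier (Kor G) = Kor_carrier G"
  by (simp add: Kor_def)

lemma topological_group_Kor: "topological_group G \<Longrightarrow> topological_group (Kor G)"
  unfolding Kor_def
  by (intro topological_group.topological_group_subgroup topological_group.subgroup_Kor_carrier)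

text \<open>Test x against the pullback \<open>\<rho> \<circ> \<phi>\<close> of an arbitrary
  representation \<open>\<rho>\<close> of H: its kernel contains x exactly when x lies in G and
  \<open>\<rho>\<close> kills \<open>\<phi> x\<close>.\<close>

lemma Kor_carrier_image:
  assumes "topological_group G" and \<phi>: "\<phi> \<in> continuous_hom G H" and x: "x \<in> Kor_carrier G"
  shows "\<phi> x \<in> Kor_carrier H"
  unfolding Kor_carrier_def
proof clarify
  fix n \<rho> assume "ordinary_representation H n \<rho>"
  then have "ordinary_representation G n (\<rho> \<circ> \<phi>)"
    using continuous_hom_compose[OF \<phi>] by (auto simp: ordinary_representation_def)
  then have "x \<in> kernel G (GL n) (\<rho> \<circ> \<phi>)"
    using x by (auto simp: Kor_carrier_def)
  then show "\<phi> x \<in> kernel H (GL n) \<rho>"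
    using \<phi> by (auto simp: kernel_def continuous_hom_def hom_def)
qed

lemma Kor_mor_continuous_hom:
  assumes G: "topological_group G" and \<phi>: "\<phi> \<in> continuous_hom G H"
  shows "Kor_mor G H \<phi> \<in> continuous_hom (Kor G) (Kor H)"
proof -
  interpret topological_group G by fact
  interpret K: subgroup "Kor_carrier G" G by (rule subgroup_Kor_carrier)
  have img: "\<phi> \<in> Kor_carrier G \<rightarrow> Kor_carrier H"
    using Kor_carrier_image[OF G \<phi>] by auto
  have "Kor_mor G H \<phi> \<in> hom (Kor G) (Kor H)"
    using \<phi> img by (auto simp: hom_def continuous_hom_def Kor_mor_def Kor_def)
  \<comment> \<open>Continuity is shown for \<open>\<phi>\<close> itself and then carried over to
    its restriction, which agrees with it on Kor(G).\<close>
  moreover have "continuous_map (grp_top (Kor G)) (grp_top (Kor H)) \<phi>"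
    using \<phi> img
    by (auto simp: Kor_def continuous_hom_def continuous_map_in_subtopology
        continuous_map_from_subtopology)
  then have "continuous_map (grp_top (Kor G)) (grp_top (Kor H)) (Kor_mor G H \<phi>)"
    by (rule continuous_map_eq) (simp add: Kor_mor_def Kor_def)
  ultimately show ?thesis
    by (simp add: continuous_hom_def)
qed

text \<open>On Kor(G) the maps \<open>\<phi>\<close> and \<open>Kor_mor G H \<phi>\<close> have the
  same image, and the latter is a homomorphism between groups.\<close>

lemma subgroup_Kor_image:
  assumes "topological_group G" "topological_group H" "\<phi> \<in> continuous_hom G H"
  shows "subgroup (\<phi> ` carrier (Kor G)) (Kor H)"
proof -
  interpret KG: topological_group "Kor G" by (rule topological_group_Kor) fact
  interpret KH: topological_group "Kor H" by (rule topological_group_Kor) fact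
  interpret group_hom "Kor G" "Kor H" "Kor_mor G H \<phi>"
    using Kor_mor_continuous_hom[OF assms(1,3)]
    by unfold_locales (simp add: continuous_hom_def)
  show ?thesis
    using img_is_subgroup by (simp add: Kor_mor_def)
qed

text \<open>Identities and composites are cut off outside the carrier of their domain. Continuity
  and the homomorphism law see only values on the carrier, and extensionality turns the unit laws
  into true equalities of functions.\<close>

lemma cat_axioms_TopGrp: "cat_axioms TopGrp"
proof
  fix G :: "'u topgroup" assume "G \<in> Ob TopGrp"
  then interpret topological_group G by (simp add: TopGrp_def)
  have "continuous_map (grp_top G) (grp_top G) (\<lambda>x \<in> carrier G. x)"
    by (rule continuous_map_eq[OF continuous_map_id]) (simp add: topspace_eq)
  then show "Ident TopGrp G \<in> Hom TopGrp G G"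
    by (simp add: TopGrp_def continuous_hom_def hom_def)
next
  fix G H K :: "'u topgroup" and f g
  assume "G \<in> Ob TopGrp" and f: "f \<in> Hom TopGrp G H" and g: "g \<in> Hom TopGrp H K"
  then interpret topological_group G by (simp add: TopGrp_def)
  have gf: "g \<circ> f \<in> continuous_hom G K"
    using f g by (intro continuous_hom_compose) (auto simp: TopGrp_def)
  then have "continuous_map (grp_top G) (grp_top K) (compose (carrier G) g f)"
    by (intro continuous_map_eq[where f = "g \<circ> f" and g = "compose (carrier G) g f"])
      (simp_all add: continuous_hom_def topspace_eq compose_eq)
  moreover have "compose (carrier G) g f \<in> hom G K"
    using gf by (auto simp: continuous_hom_def hom_def compose_eq)
  ultimately show "Comp TopGrp G H K g f \<in> Hom TopGrp G K"
    by (simp add: TopGrp_def continuous_hom_def)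
next
  fix G H :: "'u topgroup" and f
  assume "f \<in> Hom TopGrp G H"
  then have f: "f \<in> carrier G \<rightarrow> carrier H" "f \<in> extensional (carrier G)"
    by (simp_all add: TopGrp_def continuous_hom_def hom_def)
  show "Comp TopGrp G H H (Ident TopGrp H) f = f"
    using Id_compose[OF f] by (simp add: TopGrp_def)
  show "Comp TopGrp G G H f (Ident TopGrp G) = f"
    using compose_Id[OF f] by (simp add: TopGrp_def)
next
  fix G H K L :: "'u topgroup" and f g h
  assume "f \<in> Hom TopGrp G H"
  then have "f \<in> carrier G \<rightarrow> carrier H"
    by (simp add: TopGrp_def continuous_hom_def hom_def)
  from compose_assoc[OF this, of h g, symmetric]
  show "Comp TopGrp G H L (Comp TopGrp H K L h g) f = Comp TopGrp G K L h (Comp TopGrp G H K g f)"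
    by (simp add: TopGrp_def)
qed

lemma cat_functor_Kor: "cat_functor TopGrp TopGrp Kor Kor_mor"
proof (intro cat_functor.intro cat_functor_axioms.intro cat_axioms_TopGrp)
  fix G :: "'u topgroup" assume G: "G \<in> Ob TopGrp"
  then show "Kor G \<in> Ob TopGrp"
    by (simp add: TopGrp_def topological_group_Kor)
  \<comment> \<open>The identity is restricted twice, to G and then to Kor(G); the inclusion makes
    the first restriction redundant.\<close>
  have "Kor_carrier G \<subseteq> carrier G"
    using G Kor_carrier_subset by (simp add: TopGrp_def)
  then show "Kor_mor G G (Ident TopGrp G) = Ident TopGrp (Kor G)"
    by (simp add: TopGrp_def Kor_mor_def carrier_Kor Int_absorb1)
next
  fix G H :: "'u topgroup" and \<phi>
  assume "G \<in> Ob TopGrp" "\<phi> \<in> Hom TopGrp G H"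
  then show "Kor_mor G H \<phi> \<in> Hom TopGrp (Kor G) (Kor H)"
    using Kor_mor_continuous_hom[of G \<phi> H] by (simp add: TopGrp_def Kor_mor_def)
next
  fix G H K :: "'u topgroup" and \<phi> \<psi>
  assume G: "G \<in> Ob TopGrp" and \<phi>: "\<phi> \<in> Hom TopGrp G H"
  have "Kor_carrier G \<subseteq> carrier G"
    using G Kor_carrier_subset by (simp add: TopGrp_def)
  \<comment> \<open>Composing the restrictions evaluates the cut-off \<open>\<psi>\<close> at
    \<open>\<phi> x\<close>, where it agrees with \<open>\<psi>\<close> only because
    \<open>\<phi> x\<close> lies in Kor(H).\<close>
  moreover have "\<phi> x \<in> Kor_carrier H" if "x \<in> Kor_carrier G" for x
    using G \<phi> that Kor_carrier_image[of G \<phi> H x] by (simp add: TopGrp_def)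
  ultimately show "Kor_mor G K (Comp TopGrp G H K \<psi> \<phi>)
      = Comp TopGrp (Kor G) (Kor H) (Kor K) (Kor_mor H K \<psi>) (Kor_mor G H \<phi>)"
    by (intro ext) (simp add: TopGrp_def Kor_mor_def carrier_Kor compose_def restrict_def subset_iff)
qed

theorem mainTheorem11:
  shows "(\<forall>(G :: 'a topgroup) (H :: 'b topgroup) \<phi>.
            topological_group G \<longrightarrow> topological_group H \<longrightarrow> \<phi> \<in> continuous_hom G H \<longrightarrow>
              subgroup (\<phi> ` carrier (Kor G)) (Kor H) \<and>
              Kor_mor G H \<phi> \<in> continuous_hom (Kor G) (Kor H))
       \<and> cat_functor (TopGrp :: ('u topgroup, 'u \<Rightarrow> 'u) cat) TopGrp Kor Kor_mor"
  using subgroup_Kor_image Kor_mor_continuous_hom cat_functor_Kor by blast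

end
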